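(* Let $r,s$ be positive integers and let $f:\mathbb Z^+\to\{-r,s\}$ be a function such that $|f([n])|=o(n)$ as $n\to\infty$. Then for every positive integer $k$ divisible by $r+s$, there are infinitely many $k$-blocks $B\subseteq\mathbb Z^+$ with $f(B)=0$.
   Context: $[n]=\{1,\ldots,n\}$; for $Y\subseteq\mathbb Z^+$ finite, $f(Y)=\sum_{y\in Y}f(y)$. A $k$-block is a set of $k$ consecutive integers. *)

theory Defs
  imports "HOL-Library.Landau_Symbols"
begin

(* Positive integers are elements of nat that are at least 1; functions on them are functions on
   nat whose value at 0 is left unconstrained. Only blocks consisting of positive integers are
   ever considered, so working in nat rather than int loses none of them. *)
definition is_block :: "nat \<Rightarrow> nat set \<Rightarrow> bool" where
  "is_block k B \<longleftrightarrow> (\<exists>a. B = {a..<a + k})"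

end

theory Submission
  imports Defs
begin

text \<open>
  The sum over a sliding \<open>k\<close>-block is always a multiple of \<open>r + s\<close> and changes by at most \<open>r + s\<close>
  when the block is shifted by one, so it cannot change sign without vanishing. If only finitely many
  block sums vanish, then from some point on all of them have the same sign and absolute value at
  least \<open>1\<close>; concatenating consecutive blocks makes \<open>\<bar>f([n])\<bar>\<close> grow linearly.
\<close>

text \<open>Adding \<open>a\<close> to every value turns \<open>- a\<close> and \<open>b\<close>
  into \<open>0\<close> and \<open>a + b\<close>, so the shifted sum is divisible by
  \<open>a + b\<close>; the total shift \<open>card A * a\<close> is divisible as well.\<close>

lemma dvd_sum_two_valued:
  fixes f :: "'a \<Rightarrow> int"
  assumes "\<And>x. x \<in> A \<Longrightarrow> f x \<in> {- a, b}" and "a + b dvd int (card A)"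
  shows "a + b dvd sum f A"
proof -
  have "a + b dvd (\<Sum>x\<in>A. f x + a)"
    using assms(1) by (intro dvd_sum) (fastforce simp: add.commute)
  moreover have "(\<Sum>x\<in>A. f x + a) = sum f A + int (card A) * a"
    by (simp add: sum.distrib)
  ultimately show ?thesis
    using assms(2) by (simp add: dvd_add_left_iff)
qed

text \<open>A nonzero multiple of \<open>d\<close> lies at distance at least \<open>d\<close> from
  0, so a step of size at most \<open>d\<close> can reach 0 but cannot pass it, and reaching 0 is
  excluded.\<close>

lemma constant_sgn_if_small_steps:
  fixes g :: "nat \<Rightarrow> int"
  assumes dvd: "\<And>n. n \<ge> N \<Longrightarrow> d dvd g n"
    and step: "\<And>n. n \<ge> N \<Longrightarrow> \<bar>g (Suc n) - g n\<bar> \<le> d"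
    and nz: "\<And>n. n \<ge> N \<Longrightarrow> g n \<noteq> 0"
    and "n \<ge> N"
  shows "sgn (g n) = sgn (g N)"
  using \<open>n \<ge> N\<close>
proof (induction n rule: dec_induct)
  case base
  show ?case ..
next
  case (step n)
  have "\<bar>g n\<bar> \<ge> d"
    using zdvd_imp_le[of d "\<bar>g n\<bar>"] dvd[of n] nz[of n] step.hyps by simp
  then have "sgn (g (Suc n)) = sgn (g n)"
    using assms(2)[of n] nz[of n] nz[of "Suc n"] step.hyps by (auto simp: sgn_if)
  then show ?case
    using step.IH by simp
qed

lemma sum_consecutive_blocks_ge:
  fixes f :: "nat \<Rightarrow> int"
  assumes "\<And>n. n \<ge> N \<Longrightarrow> sum f {n..<n + k} \<ge> 1"
  shows "sum f {N..<N + m * k} \<ge> int m"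
proof (induction m)
  case (Suc m)
  have "sum f {N..<N + Suc m * k} = sum f {N..<N + m * k} + sum f {N + m * k..<(N + m * k) + k}"
    using sum.atLeastLessThan_concat[of N "N + m * k" "N + m * k + k" f] by (simp add: ac_simps)
  then show ?case
    using Suc assms[of "N + m * k"] by simp
qed simp

text \<open>Each block of length \<open>k\<close> contributes at least 1, so the partial sums grow
  with slope at least \<open>1 / k\<close>, up to the constant contribution of the terms before
  \<open>N\<close>.\<close>

lemma not_smallo_if_block_sums_ge:
  fixes f :: "nat \<Rightarrow> int"
  assumes "k \<ge> 1" and "N \<ge> 1"
    and blocks: "\<And>n. n \<ge> N \<Longrightarrow> sum f {n..<n + k} \<ge> 1"
  shows "(\<lambda>n::nat. real_of_int \<bar>\<Sum>y\<in>{1..n}. f y\<bar>) \<notin> o(\<lambda>n. real n)"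
proof
  assume "(\<lambda>n::nat. real_of_int \<bar>\<Sum>y\<in>{1..n}. f y\<bar>) \<in> o(\<lambda>n. real n)"
  \<comment> \<open>The constant is half of the slope \<open>1 / k\<close> that the blocks
    force.\<close>
  then have "eventually (\<lambda>n. norm (real_of_int \<bar>\<Sum>y\<in>{1..n}. f y\<bar>) \<le> 1 / (2 * real k) * norm (real n)) at_top"
    using \<open>k \<ge> 1\<close> by (intro landau_o.smallD) auto
  then obtain M where M: "real_of_int \<bar>sum f {1..n}\<bar> \<le> real n / (2 * real k)" if "n \<ge> M" for n
    by (auto simp: eventually_at_top_linorder)
  define C where "C = \<bar>sum f {1..<N}\<bar>"
  \<comment> \<open>The summand \<open>M\<close> gives \<open>n \<ge> M\<close>; the rest makes
    \<open>m\<close> exceed \<open>2 * C + N\<close>, the upper bound that the estimates below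
    yield.\<close>
  define m where "m = M + 2 * nat C + N + 1"
  \<comment> \<open>With the \<open>- 1\<close>, \<open>{1..n}\<close> ends exactly where the last
    of the \<open>m\<close> blocks ends.\<close>
  define n where "n = N + m * k - 1"
  have "m \<le> m * k"
    using \<open>k \<ge> 1\<close> by simp
  then have "n \<ge> M"
    using \<open>N \<ge> 1\<close> unfolding n_def m_def by linarith
  have "real n \<le> real N + real m * real k"
    by (simp add: n_def flip: of_nat_mult of_nat_add)
  have "{1..n} = {1..<N + m * k}"
    using \<open>N \<ge> 1\<close> by (auto simp: n_def)
  then have "sum f {1..n} = sum f {1..<N} + sum f {N..<N + m * k}"
    using sum.atLeastLessThan_concat[of 1 N "N + m * k" f] \<open>N \<ge> 1\<close> by simp
  then have "sum f {1..n} \<ge> int m - C"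
    using sum_consecutive_blocks_ge[of N f k m, OF blocks] by (simp add: C_def)
  then have "real m - real_of_int C \<le> real_of_int \<bar>sum f {1..n}\<bar>"
    by linarith
  also have "\<dots> \<le> (real N + real m * real k) / (2 * real k)"
    using M[OF \<open>n \<ge> M\<close>] \<open>real n \<le> _\<close> by (smt (verit) divide_right_mono of_nat_0_le_iff)
  also have "\<dots> = real N / (2 * real k) + real m / 2"
    using \<open>k \<ge> 1\<close> by (simp add: field_simps)
  also have "real N / (2 * real k) \<le> real N / 2"
    using \<open>k \<ge> 1\<close> by (intro divide_left_mono) auto
  finally have "real m \<le> 2 * real_of_int C + real N"
    by simp
  moreover have "real m \<ge> 2 * real_of_int C + real N + 1"
    by (simp add: m_def C_def)
  ultimately show False
    by simp
qed

theorem theorem2p16: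
  fixes r s :: nat and f :: "nat \<Rightarrow> int"
  assumes "r \<ge> 1" and "s \<ge> 1"
    and "\<And>n. n \<ge> 1 \<Longrightarrow> f n \<in> {- int r, int s}"
    and "(\<lambda>n::nat. real_of_int \<bar>\<Sum>y\<in>{1..n}. f y\<bar>) \<in> o(\<lambda>n. real n)"
  shows "\<forall>k::nat. k \<ge> 1 \<and> (r + s) dvd k \<longrightarrow>
           infinite {B. is_block k B \<and> B \<subseteq> {1..} \<and> (\<Sum>y\<in>B. f y) = 0}"
proof (intro allI impI notI)
  fix k :: nat
  assume k: "k \<ge> 1 \<and> (r + s) dvd k"
    and fin: "finite {B. is_block k B \<and> B \<subseteq> {1..} \<and> (\<Sum>y\<in>B. f y) = 0}"
  define g where "g n = sum f {n..<n + k}" for n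
  \<comment> \<open>As \<open>k \<ge> 1\<close>, a block determines its starting point, so finitely
    many vanishing blocks mean finitely many starting points.\<close>
  have "inj_on (\<lambda>n. {n..<n + k}) {n. n \<ge> 1 \<and> g n = 0}"
    using k by (auto simp: inj_on_def atLeastLessThan_eq_iff)
  moreover have "(\<lambda>n. {n..<n + k}) ` {n. n \<ge> 1 \<and> g n = 0} \<subseteq>
      {B. is_block k B \<and> B \<subseteq> {1..} \<and> (\<Sum>y\<in>B. f y) = 0}"
    by (auto simp: is_block_def g_def)
  ultimately have "finite {n. n \<ge> 1 \<and> g n = 0}"
    using fin inj_on_finite by blast
  then obtain N0 where N0: "\<forall>n\<in>{n. n \<ge> 1 \<and> g n = 0}. n < N0"
    using finite_nat_set_iff_bounded by blast
  \<comment> \<open>The successor ensures \<open>N \<ge> 1\<close>, so the unconstrained value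
    \<open>f 0\<close> never enters a block.\<close>
  define N where "N = Suc N0"
  have nz: "g n \<noteq> 0" if "n \<ge> N" for n
    using bspec[OF N0, of n] that by (auto simp: N_def)
  have dvd: "int r + int s dvd g n" if "n \<ge> N" for n
    unfolding g_def
  proof (rule dvd_sum_two_valued)
    show "f x \<in> {- int r, int s}" if "x \<in> {n..<n + k}" for x
      using assms(3)[of x] that \<open>n \<ge> N\<close> by (simp add: N_def)
    show "int r + int s dvd int (card {n..<n + k})"
      using k by (simp flip: of_nat_add)
  qed
  have step: "\<bar>g (Suc n) - g n\<bar> \<le> int r + int s" if "n \<ge> N" for n
  proof -
    \<comment> \<open>Both sides are the sum over \<open>{n..<Suc (n + k)}\<close>: shifting drops
      \<open>f n\<close> and gains \<open>f (n + k)\<close>, and two values of \<open>f\<close>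
      differ by 0 or \<open>r + s\<close>.\<close>
    have "g (Suc n) + f n = g n + f (n + k)"
      using k sum.atLeast_Suc_lessThan[of n "Suc (n + k)" f] by (simp add: g_def)
    then show ?thesis
      using assms(3)[of n] assms(3)[of "n + k"] that by (auto simp: N_def)
  qed
  \<comment> \<open>Multiplying \<open>f\<close> by the common sign \<open>c\<close> reduces the
    negative case to the positive one and leaves the absolute values of the partial sums
    unchanged.\<close>
  define c where "c = sgn (g N)"
  have c: "\<bar>c\<bar> = 1"
    using nz[of N] by (simp add: c_def abs_sgn_eq)
  have "(\<Sum>y\<in>{n..<n + k}. c * f y) \<ge> 1" if "n \<ge> N" for n
  proof -
    have "sgn (g n) = c"
      unfolding c_def using dvd step nz that by (rule constant_sgn_if_small_steps)
    then have "c * g n = \<bar>g n\<bar>"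
      by (simp add: abs_sgn mult.commute)
    then show ?thesis
      using nz[OF that] by (simp add: g_def sum_distrib_left)
  qed
  then have "(\<lambda>n::nat. real_of_int \<bar>\<Sum>y\<in>{1..n}. c * f y\<bar>) \<notin> o(\<lambda>n. real n)"
    using k by (intro not_smallo_if_block_sums_ge[of k N]) (auto simp: N_def)
  moreover have "\<bar>\<Sum>y\<in>{1..n}. c * f y\<bar> = \<bar>\<Sum>y\<in>{1..n}. f y\<bar>" for n
    using c by (simp add: abs_mult flip: sum_distrib_left)
  ultimately show False
    using assms(4) by (simp only: not_True_eq_False)
qed

end
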